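(* Let $f(x,t)=V_x(x,t)$, $x\in\mathbb{R}^n$, where the real scalar function $V(x,t)$ is twice differentiable in $x$. Then the Lipschitz constant of $f$ with respect to the Euclidean norm is minimal among all norms: for every norm $\|\cdot\|$ on $\mathbb{R}^n$ and every $t$, $L_E(t)\le L(t)$, where $L_E(t)$ and $L(t)$ are the Lipschitz constants of $f(\cdot,t)$ with respect to the Euclidean norm and the norm $\|\cdot\|$, respectively.
   Context: $V_x$ denotes the gradient of $V$ with respect to $x$. The Lipschitz constant of $f(\cdot,t)$ in a norm $\|\cdot\|$ is the smallest $L(t)$ with $\|f(x',t)-f(x'',t)\|\le L(t)\|x'-x''\|$ for all $x',x''\in\mathbb{R}^n$; equivalently $L(t)=\sup_{x\in\mathbb{R}^n}\|f_x(x,t)\|$ with the induced operator norm of the Jacobian matrix $f_x$. *)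

theory Defs
  imports "HOL-Analysis.Analysis"
begin

definition is_norm :: "('a::real_vector \<Rightarrow> real) \<Rightarrow> bool" where
  "is_norm N \<longleftrightarrow>
     (\<forall>x. 0 \<le> N x) \<and>
     (\<forall>x. N x = 0 \<longleftrightarrow> x = 0) \<and>
     (\<forall>c x. N (c *\<^sub>R x) = \<bar>c\<bar> * N x) \<and>
     (\<forall>x y. N (x + y) \<le> N x + N y)"

lemma is_norm_norm: "is_norm (norm :: 'a::real_normed_vector \<Rightarrow> real)"
  unfolding is_norm_def by (auto intro: norm_triangle_ineq)

text \<open>
  The Lipschitz constant is extended-real valued: it is \<open>\<infinity>\<close>, the infimum of the empty set,
  if \<open>g\<close> is not Lipschitz with respect to \<open>N\<close>. Otherwise the infimum is attained, as
  \<open>lipschitz_constant_le_iff\<close> shows, so it is the smallest admissible constant.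
\<close>

definition lipschitz_constant ::
  "('a::real_vector \<Rightarrow> real) \<Rightarrow> ('a \<Rightarrow> 'a) \<Rightarrow> ereal" where
  "lipschitz_constant N g =
     Inf {ereal L | L. \<forall>x' x''. N (g x' - g x'') \<le> L * N (x' - x'')}"

lemma lipschitz_constant_le_iff:
  assumes "is_norm N"
  shows "lipschitz_constant N g \<le> ereal L \<longleftrightarrow>
           (\<forall>x' x''. N (g x' - g x'') \<le> L * N (x' - x''))"
proof
  assume le: "lipschitz_constant N g \<le> ereal L"
  show "\<forall>x' x''. N (g x' - g x'') \<le> L * N (x' - x'')"
  proof (intro allI)
    fix x' x''
    have nonneg: "0 \<le> N (x' - x'')"
      using assms by (simp add: is_norm_def)
    have approx: "N (g x' - g x'') \<le> (L + e) * N (x' - x'')" if "e > 0" for e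
    proof -
      have "lipschitz_constant N g < ereal (L + e)"
        using le that by (meson ereal_less(2) le_less_trans less_add_same_cancel1 less_ereal.simps(1))
      then obtain K where K: "K < L + e"
          "\<And>x' x''. N (g x' - g x'') \<le> K * N (x' - x'')"
        unfolding lipschitz_constant_def Inf_less_iff by auto
      have "K * N (x' - x'') \<le> (L + e) * N (x' - x'')"
        using K(1) nonneg by (intro mult_right_mono) auto
      with K(2) show ?thesis
        by (rule order_trans)
    qed
    have "((\<lambda>e. (L + e) * N (x' - x'')) \<longlongrightarrow> (L + 0) * N (x' - x'')) (at_right 0)"
      by (intro tendsto_intros)
    moreover have "\<forall>\<^sub>F e in at_right 0. N (g x' - g x'') \<le> (L + e) * N (x' - x'')"
      using approx by (auto simp: eventually_at_filter)
    ultimately show "N (g x' - g x'') \<le> L * N (x' - x'')"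
      using tendsto_lowerbound by fastforce
  qed
next
  assume "\<forall>x' x''. N (g x' - g x'') \<le> L * N (x' - x'')"
  then show "lipschitz_constant N g \<le> ereal L"
    unfolding lipschitz_constant_def by (intro Inf_lower) auto
qed

end

theory Submission
  imports Defs
begin

text \<open>
  At a point \<open>x\<close> let \<open>A\<close> be the derivative of the gradient field, that is, the Hessian of the
  potential. It is symmetric (\<open>derivative_of_gradient_symmetric\<close>): second differences of the
  potential do not depend on the order of the two directions, and they approximate the Hessian
  form as soon as the gradient is differentiable at \<open>x\<close>. For a symmetric \<open>A\<close> the Euclidean
  operator norm \<open>m\<close> is the smallest of all operator norms, because it is a spectral radius: a unit vector \<open>v\<close> at which
  \<open>|A v|\<close> attains its maximum \<open>m\<close> satisfies \<open>A (A v) = m\<^sup>2 v\<close>. If \<open>N (A h) \<le> L N h\<close> for all \<open>h\<close>,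
  applying this twice to \<open>v\<close> gives \<open>m\<^sup>2 N v \<le> L\<^sup>2 N v\<close>, hence \<open>m \<le> L\<close>
  (\<open>symmetric_operator_norm_le\<close>).

  A constant \<open>L\<close> that is admissible for the field with respect to \<open>N\<close> bounds the difference
  quotients of the field, and in the limit its derivatives, in \<open>N\<close>
  (\<open>derivative_bound_of_lipschitz\<close>). By the above it then
  bounds the derivatives in the Euclidean norm, and the mean value inequality shows that \<open>L\<close> is
  admissible with respect to the Euclidean norm.
\<close>

section \<open>Symmetry of the Hessian\<close>

text \<open>
  The second difference of \<open>\<phi>\<close> along \<open>u\<close> and \<open>v\<close> is symmetric in \<open>u\<close> and \<open>v\<close>, whereas
  the approximation \<open>s\<^sup>2 (A v \<bullet> u)\<close> is not visibly so; applying the estimate to both orders compares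
  \<open>A v \<bullet> u\<close> with \<open>A u \<bullet> v\<close>. The mean value theorem is used only in the direction \<open>u\<close>, which
  leaves the difference of two gradient values near \<open>x\<close>. Both are compared with the linearization
  of the gradient at the single point \<open>x\<close>.
\<close>

lemma second_difference_estimate:
  fixes \<phi> :: "'a::real_inner \<Rightarrow> real"
  assumes grad: "\<And>y. GDERIV \<phi> y :> g y"
    and lin: "linear A"
    and approx: "\<And>h. norm h < d \<Longrightarrow> norm (g (x + h) - g x - A h) \<le> e * norm h"
    and s: "0 < s" "s * (norm u + norm v) < d" and e: "0 < e"
  shows "\<bar>\<phi> (x + s *\<^sub>R u + s *\<^sub>R v) - \<phi> (x + s *\<^sub>R u) - \<phi> (x + s *\<^sub>R v) + \<phi> x - s\<^sup>2 * (A v \<bullet> u)\<bar>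
           \<le> 2 * e * s\<^sup>2 * (norm u + norm v)\<^sup>2"
proof -
  let ?K = "norm u + norm v"
  let ?\<psi> = "\<lambda>r. \<phi> (x + r *\<^sub>R u + s *\<^sub>R v) - \<phi> (x + r *\<^sub>R u)"
  have phi: "(\<phi> has_derivative (\<lambda>h. h \<bullet> g y)) (at y)" for y
    using grad[of y] by (simp add: gderiv_def)
  have der: "DERIV ?\<psi> r :> (g (x + r *\<^sub>R u + s *\<^sub>R v) - g (x + r *\<^sub>R u)) \<bullet> u" for r
  proof -
    have 1: "((\<lambda>r. \<phi> (x + r *\<^sub>R u + s *\<^sub>R v)) has_derivative
            (\<lambda>h. (h *\<^sub>R u) \<bullet> g (x + r *\<^sub>R u + s *\<^sub>R v))) (at r)"
      by (rule has_derivative_compose[OF _ phi]) (auto intro!: derivative_eq_intros)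
    have 2: "((\<lambda>r. \<phi> (x + r *\<^sub>R u)) has_derivative
            (\<lambda>h. (h *\<^sub>R u) \<bullet> g (x + r *\<^sub>R u))) (at r)"
      by (rule has_derivative_compose[OF _ phi]) (auto intro!: derivative_eq_intros)
    show ?thesis
      using has_derivative_diff[OF 1 2] unfolding has_field_derivative_def
      by (rule has_derivative_eq_rhs) (auto simp: fun_eq_iff inner_diff_left inner_commute algebra_simps)
  qed
  obtain z where z: "0 < z" "z < s"
    and mvt: "?\<psi> s - ?\<psi> 0 = (s - 0) * ((g (x + z *\<^sub>R u + s *\<^sub>R v) - g (x + z *\<^sub>R u)) \<bullet> u)"
    using MVT2[OF s(1) der] by blast
  let ?a = "z *\<^sub>R u + s *\<^sub>R v" and ?b = "z *\<^sub>R u"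
  have na: "norm ?a \<le> s * ?K"
  proof -
    have "norm ?a \<le> z * norm u + s * norm v"
      using norm_triangle_ineq[of "z *\<^sub>R u" "s *\<^sub>R v"] z s by simp
    also have "\<dots> \<le> s * norm u + s * norm v"
      using z by (simp add: mult_right_mono)
    finally show ?thesis by (simp add: algebra_simps)
  qed
  have nb: "norm ?b \<le> s * ?K"
    using z s by (simp add: mult_mono)
  let ?p = "g (x + ?a) - g x - A ?a" and ?q = "g (x + ?b) - g x - A ?b"
  have pq: "norm ?p \<le> e * (s * ?K)" "norm ?q \<le> e * (s * ?K)"
    using approx[of ?a] approx[of ?b] na nb s e
    by (meson mult_left_mono order.trans le_less_trans less_imp_le)+
  have "A ?a - A ?b = s *\<^sub>R A v"
    using lin by (simp add: linear_add linear_scale)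
  then have "g (x + ?a) - g (x + ?b) = s *\<^sub>R A v + (?p - ?q)"
    by (simp add: algebra_simps)
  then have "?\<psi> s - ?\<psi> 0 - s\<^sup>2 * (A v \<bullet> u) = s * ((?p - ?q) \<bullet> u)"
    using mvt by (simp add: inner_add_left power2_eq_square algebra_simps)
  also have "\<bar>\<dots>\<bar> \<le> s * (2 * e * (s * ?K) * ?K)"
  proof -
    have "\<bar>(?p - ?q) \<bullet> u\<bar> \<le> norm (?p - ?q) * norm u"
      by (rule Cauchy_Schwarz_ineq2)
    also have "\<dots> \<le> (2 * e * (s * ?K)) * ?K"
      using norm_triangle_ineq4[of ?p ?q] pq s e by (intro mult_mono) auto
    finally show ?thesis
      using s by (simp add: abs_mult)
  qed
  finally show ?thesis
    by (simp add: power2_eq_square algebra_simps)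
qed

lemma derivative_of_gradient_symmetric:
  fixes \<phi> :: "'a::real_inner \<Rightarrow> real"
  assumes grad: "\<And>y. GDERIV \<phi> y :> g y"
    and der: "(g has_derivative A) (at x)"
  shows "A u \<bullet> v = u \<bullet> A v"
proof -
  let ?K = "norm u + norm v"
  have lin: "linear A"
    using der by (rule has_derivative_linear)
  have bound: "\<bar>A v \<bullet> u - A u \<bullet> v\<bar> \<le> e * (4 * ?K\<^sup>2)" if e: "0 < e" for e
  proof -
    obtain d where d: "0 < d"
      "\<And>y. norm (y - x) < d \<Longrightarrow> norm (g y - g x - A (y - x)) \<le> e * norm (y - x)"
      using der e unfolding has_derivative_at_alt by blast
    have approx: "norm (g (x + h) - g x - A h) \<le> e * norm h" if "norm h < d" for h
      using d(2)[of "x + h"] that by simp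
    \<comment> \<open>the summand 1 keeps the denominator positive when \<open>u = v = 0\<close>\<close>
    define s where "s = d / (?K + 1)"
    have K: "0 < ?K + 1"
      by (simp add: add_nonneg_pos)
    then have s: "0 < s"
      using d(1) by (simp add: s_def)
    have "s * ?K < s * (?K + 1)"
      using s by (intro mult_strict_left_mono) auto
    then have sK: "s * ?K < d"
      using K by (simp add: s_def)
    let ?\<Delta> = "\<phi> (x + s *\<^sub>R u + s *\<^sub>R v) - \<phi> (x + s *\<^sub>R u) - \<phi> (x + s *\<^sub>R v) + \<phi> x"
    have 1: "\<bar>?\<Delta> - s\<^sup>2 * (A v \<bullet> u)\<bar> \<le> 2 * e * s\<^sup>2 * ?K\<^sup>2"
      by (rule second_difference_estimate[OF grad lin approx s sK e])
    have swap: "x + s *\<^sub>R v + s *\<^sub>R u = x + s *\<^sub>R u + s *\<^sub>R v"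
      by simp
    have sK': "s * (norm v + norm u) < d"
      using sK by (simp add: add.commute)
    have 2: "\<bar>?\<Delta> - s\<^sup>2 * (A u \<bullet> v)\<bar> \<le> 2 * e * s\<^sup>2 * ?K\<^sup>2"
      using second_difference_estimate[OF grad lin approx s sK' e]
      unfolding swap add.commute[of "norm v"] by (simp add: algebra_simps)
    have "s\<^sup>2 * \<bar>A v \<bullet> u - A u \<bullet> v\<bar> = \<bar>s\<^sup>2 * (A v \<bullet> u) - s\<^sup>2 * (A u \<bullet> v)\<bar>"
      by (simp add: abs_mult flip: right_diff_distrib)
    also have "\<dots> \<le> s\<^sup>2 * (e * (4 * ?K\<^sup>2))"
      using 1 2 by (simp add: abs_le_iff algebra_simps)
    finally show ?thesis
      using s by simp
  qed
  have "\<bar>A v \<bullet> u - A u \<bullet> v\<bar> \<le> 0 + r" if r: "0 < r" for r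
  proof -
    have K: "0 < 4 * ?K\<^sup>2 + 1"
      by (simp add: add_nonneg_pos)
    have "\<bar>A v \<bullet> u - A u \<bullet> v\<bar> \<le> r / (4 * ?K\<^sup>2 + 1) * (4 * ?K\<^sup>2)"
      using r K by (intro bound) simp
    also have "\<dots> \<le> r / (4 * ?K\<^sup>2 + 1) * (4 * ?K\<^sup>2 + 1)"
      using r K by (intro mult_left_mono) auto
    also have "\<dots> = r"
      using K by simp
    finally show ?thesis by simp
  qed
  then have "\<bar>A v \<bullet> u - A u \<bullet> v\<bar> \<le> 0"
    by (rule field_le_epsilon)
  then show ?thesis
    by (simp add: inner_commute)
qed

section \<open>Operator norms of symmetric maps\<close>

lemma is_norm_convex:
  assumes "is_norm N"
  shows "convex_on UNIV N"
proof (rule convex_onI)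
  fix t :: real and x y
  assume t: "0 < t" "t < 1"
  have "N ((1 - t) *\<^sub>R x + t *\<^sub>R y) \<le> N ((1 - t) *\<^sub>R x) + N (t *\<^sub>R y)"
    using assms unfolding is_norm_def by blast
  also have "\<dots> = \<bar>1 - t\<bar> * N x + \<bar>t\<bar> * N y"
    using assms unfolding is_norm_def by metis
  finally show "N ((1 - t) *\<^sub>R x + t *\<^sub>R y) \<le> (1 - t) * N x + t * N y"
    using t by simp
qed simp

text \<open>
  Being convex, a norm on a Euclidean space is continuous, so a bound on difference quotients
  passes to their limit.
\<close>

lemma derivative_bound_of_lipschitz:
  fixes g :: "'a::euclidean_space \<Rightarrow> 'a"
  assumes N: "is_norm N"
    and lip: "\<And>x y. N (g x - g y) \<le> L * N (x - y)"
    and der: "(g has_derivative A) (at x)"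
  shows "N (A h) \<le> L * N h"
proof -
  have scale: "N (c *\<^sub>R y) = \<bar>c\<bar> * N y" for c y
    using N unfolding is_norm_def by blast
  have cont: "continuous_on UNIV N"
    using is_norm_convex[OF N] by (intro convex_on_continuous) auto
  have lin: "linear A"
    using der by (rule has_derivative_linear)
  have "((\<lambda>s. g (x + s *\<^sub>R h)) has_derivative (\<lambda>s. A (s *\<^sub>R h))) (at (0::real))"
    by (rule has_derivative_compose[where g = g]) (auto intro!: derivative_eq_intros simp: der)
  then have "((\<lambda>s. norm (g (x + s *\<^sub>R h) - g x - A (s *\<^sub>R h)) / norm s) \<longlongrightarrow> 0) (at 0)"
    by (simp add: has_derivative_at)
  moreover have "norm (g (x + s *\<^sub>R h) - g x - A (s *\<^sub>R h)) / norm s =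
      norm ((g (x + s *\<^sub>R h) - g x) /\<^sub>R s - A h)" if "s \<noteq> 0" for s :: real
  proof -
    have "(g (x + s *\<^sub>R h) - g x) /\<^sub>R s - A h = (g (x + s *\<^sub>R h) - g x - A (s *\<^sub>R h)) /\<^sub>R s"
      using that lin by (simp add: linear_scale scaleR_diff_right)
    then show ?thesis
      by (simp add: divide_inverse)
  qed
  ultimately have "((\<lambda>s. norm ((g (x + s *\<^sub>R h) - g x) /\<^sub>R s - A h)) \<longlongrightarrow> 0) (at 0)"
    by (subst (asm) tendsto_cong) (auto simp: eventually_at_filter)
  then have "((\<lambda>s. (g (x + s *\<^sub>R h) - g x) /\<^sub>R s) \<longlongrightarrow> A h) (at (0::real))"
    by (simp add: LIM_zero_iff tendsto_norm_zero_iff)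
  then have "((\<lambda>s. N ((g (x + s *\<^sub>R h) - g x) /\<^sub>R s)) \<longlongrightarrow> N (A h)) (at (0::real))"
    using continuous_on_tendsto_compose[OF cont] by simp
  moreover have "N ((g (x + s *\<^sub>R h) - g x) /\<^sub>R s) \<le> L * N h" if "s \<noteq> 0" for s :: real
  proof -
    have "\<bar>s\<bar> * N ((g (x + s *\<^sub>R h) - g x) /\<^sub>R s) = N (g (x + s *\<^sub>R h) - g x)"
      using that by (simp flip: scale)
    also have "\<dots> \<le> L * N (s *\<^sub>R h)"
      using lip[of "x + s *\<^sub>R h" x] by simp
    also have "\<dots> = \<bar>s\<bar> * (L * N h)"
      by (simp add: scale)
    finally show ?thesis
      using that by simp
  qed
  then have "\<forall>\<^sub>F s in at (0::real). N ((g (x + s *\<^sub>R h) - g x) /\<^sub>R s) \<le> L * N h"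
    by (auto simp: eventually_at_filter)
  ultimately show ?thesis
    by (intro tendsto_upperbound) auto
qed

text \<open>
  With \<open>m\<close> the maximum of \<open>|A v|\<close> over unit vectors and \<open>v\<close> a maximizer,
  \<open>|A (A v) - m\<^sup>2 v|\<^sup>2 = |A (A v)|\<^sup>2 - 2 m\<^sup>2 |A v|\<^sup>2 + m\<^sup>4 \<le> m\<^sup>4 - 2 m\<^sup>4 + m\<^sup>4 = 0\<close>,
  where symmetry turns \<open>A (A v) \<bullet> v\<close> into \<open>|A v|\<^sup>2\<close>. Passing to the square of \<open>A\<close>
  avoids deciding which of \<open>m\<close> and \<open>-m\<close> is an eigenvalue of \<open>A\<close>.
\<close>

lemma symmetric_operator_norm_le:
  fixes A :: "'a::euclidean_space \<Rightarrow> 'a"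
  assumes lin: "linear A" and sym: "\<And>u v. A u \<bullet> v = u \<bullet> A v"
    and N: "is_norm N" and bound: "\<And>h. N (A h) \<le> L * N h"
  shows "norm (A h) \<le> L * norm h"
proof -
  have scale: "N (c *\<^sub>R y) = \<bar>c\<bar> * N y" and nonneg: "0 \<le> N y" and zero: "N y = 0 \<longleftrightarrow> y = 0" for c y
    using N unfolding is_norm_def by blast+
  have "sphere 0 1 \<noteq> ({} :: 'a set)"
    by simp
  moreover have "continuous_on (sphere 0 1) (\<lambda>v. norm (A v))"
    using lin by (intro continuous_on_norm linear_continuous_on)
      (simp add: linear_conv_bounded_linear)
  ultimately obtain v where v: "norm v = 1" and max: "\<And>y. norm y = 1 \<Longrightarrow> norm (A y) \<le> norm (A v)"
    using continuous_attains_sup[OF compact_sphere, of "0::'a" 1 "\<lambda>v. norm (A v)"] by auto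
  have Nv: "0 < N v"
    using v nonneg[of v] zero[of v] by (auto simp: less_le)
  have "0 \<le> L * N v"
    using bound[of v] nonneg[of "A v"] by linarith
  then have L: "0 \<le> L"
    using Nv by (simp add: zero_le_mult_iff)
  define m where "m = norm (A v)"
  have op: "norm (A y) \<le> m * norm y" for y
  proof (cases "y = 0")
    case True
    then show ?thesis
      using lin by (simp add: linear_0)
  next
    case False
    have "norm (A y) = norm (A (y /\<^sub>R norm y)) * norm y"
      using False lin by (simp add: linear_scale)
    also have "\<dots> \<le> m * norm y"
      using False max[of "y /\<^sub>R norm y"] by (intro mult_right_mono) (auto simp: m_def)
    finally show ?thesis .
  qed
  have "(norm (A (A v) - m\<^sup>2 *\<^sub>R v))\<^sup>2 = (norm (A (A v)))\<^sup>2 - 2 * m\<^sup>2 * (A (A v) \<bullet> v) + (m\<^sup>2)\<^sup>2 * (v \<bullet> v)"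
    unfolding power2_norm_eq_inner power2_eq_square[of "m\<^sup>2"]
    by (simp add: inner_diff_left inner_diff_right inner_commute algebra_simps)
  also have "A (A v) \<bullet> v = m\<^sup>2"
    using sym[of "A v" v] by (simp add: m_def power2_norm_eq_inner)
  also have "v \<bullet> v = 1"
    using v by (simp flip: power2_norm_eq_inner)
  also have "(norm (A (A v)))\<^sup>2 - 2 * m\<^sup>2 * m\<^sup>2 + (m\<^sup>2)\<^sup>2 * 1 \<le> 0"
  proof -
    have "norm (A (A v)) \<le> m * m"
      using op[of "A v"] by (simp add: m_def)
    then have "(norm (A (A v)))\<^sup>2 \<le> (m * m)\<^sup>2"
      by (intro power_mono) auto
    then show ?thesis
      by (simp add: power2_eq_square algebra_simps)
  qed
  finally have "A (A v) = m\<^sup>2 *\<^sub>R v"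
    by simp
  then have "m\<^sup>2 * N v = N (A (A v))"
    by (simp add: scale)
  also have "\<dots> \<le> L * N (A v)"
    by (rule bound)
  also have "\<dots> \<le> L * (L * N v)"
    using L by (rule mult_left_mono[OF bound])
  finally have "m\<^sup>2 * N v \<le> L\<^sup>2 * N v"
    by (simp add: power2_eq_square)
  then have "m\<^sup>2 \<le> L\<^sup>2"
    using Nv by simp
  then have "m \<le> L"
    using L by (rule power2_le_imp_le)
  then have "m * norm h \<le> L * norm h"
    by (intro mult_right_mono) auto
  with op[of h] show ?thesis
    by linarith
qed

section \<open>Lipschitz constants of gradient fields\<close>

theorem mainTheorem14:
  fixes V :: "real ^ 'n \<Rightarrow> real \<Rightarrow> real"
    and f :: "real ^ 'n \<Rightarrow> real \<Rightarrow> real ^ 'n"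
  assumes gradient: "\<forall>x t. GDERIV (\<lambda>y. V y t) x :> f x t"
    and twice_differentiable: "\<forall>x t. (\<lambda>y. f y t) differentiable (at x)"
  shows "\<forall>N t. is_norm N \<longrightarrow>
           lipschitz_constant norm (\<lambda>x. f x t) \<le> lipschitz_constant N (\<lambda>x. f x t)"
proof (intro allI impI)
  fix N :: "real ^ 'n \<Rightarrow> real" and t
  assume N: "is_norm N"
  let ?g = "\<lambda>x. f x t"
  define A where "A x = frechet_derivative ?g (at x)" for x
  have A: "(?g has_derivative A x) (at x)" for x
    using twice_differentiable by (simp add: A_def flip: frechet_derivative_works)
  have "norm (?g x - ?g y) \<le> L * norm (x - y)"
    if lip: "\<And>x y. N (?g x - ?g y) \<le> L * N (x - y)" for L x y
  proof (rule differentiable_bound[where S = UNIV and f' = A])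
    fix z
    have sym: "A z u \<bullet> v = u \<bullet> A z v" for u v
      using derivative_of_gradient_symmetric[OF _ A] gradient by blast
    have "norm (A z h) \<le> L * norm h" for h
      by (rule symmetric_operator_norm_le[OF has_derivative_linear[OF A] sym N])
        (rule derivative_bound_of_lipschitz[OF N lip A])
    then show "onorm (A z) \<le> L"
      by (rule onorm_le)
  qed (use A in auto)
  then show "lipschitz_constant norm ?g \<le> lipschitz_constant N ?g"
    unfolding lipschitz_constant_def by (intro Inf_superset_mono) auto
qed

end
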